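(* Let $r\ge0$ be arbitrary. Give the set $C_r$ the compact-open topology, and give $\Lambda_r\subseteq C_r$ the induced subspace topology. Define the function $\hat\phi_r:\mathbb{R}\times\hat\Omega_r\to\Lambda_r$ by $\hat\phi_r(a,\hat\omega)=\varphi_{r,a}(\hat\omega)$ for $(a,\hat\omega)\in\mathbb{R}\times\hat\Omega_r$. Then $\hat\phi_r$ is continuous. In particular, for fixed $a\in\mathbb{R}$, the function $\varphi_{r,a}:\hat\Omega_r\to\Lambda_{r,a}$ is continuous.
   Context: Fix a constant $c>0$. For $0\le r<s$ and $a,b\in\mathbb{R}$ let $F_{r,a}=\{(t,x)\in\mathbb{R}^2: r\le t,\ a-c(t-r)\le x\le a+c(t-r)\}$, $B_{s,b}=\{(t,x)\in\mathbb{R}^2: t\le s,\ b-c(s-t)\le x\le b+c(s-t)\}$, and $P^{s,b}_{r,a}=F_{r,a}\cap B_{s,b}$ (nonempty if and only if $|b-a|\le c(s-r)$). When $P^{s,b}_{r,a}\ne\emptyset$ let $I^{s,b}_{r,a}=\{x\in\mathbb{R}:(\tfrac12(r+s),x)\in P^{s,b}_{r,a}\}$, a (possibly degenerate) closed interval. Also let $I^s_{r,a}=[a-c(s-r),a+c(s-r)]$. Standing assumptions: (i) for all such $r,s,a,b$ with $P^{s,b}_{r,a}\neq\emptyset$ we are given a continuous function $\lambda^{s,b}_{r,a}:[0,1]\to I^{s,b}_{r,a}$ mapping $[0,1]$ onto $I^{s,b}_{r,a}$, such that $(a,b,r,s,\xi)\mapsto\lambda^{s,b}_{r,a}(\xi)$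 is continuous on $\{(a,b,r,s,\xi)\in\mathbb{R}^5: 0\le r<s,\ |b-a|\le c(s-r),\ \xi\in[0,1]\}$; (ii) for all $0\le r<s$ and $a\in\mathbb{R}$ we are given a continuous function $\lambda^s_{r,a}:[0,1]\to I^s_{r,a}$ onto $I^s_{r,a}$, such that $(a,r,s,\xi)\mapsto\lambda^s_{r,a}(\xi)$ is continuous on $\{(a,r,s,\xi):a\in\mathbb{R},\ 0\le r<s,\ \xi\in[0,1]\}$. For $0\le r<s$ let $t_{nj}=r+\frac{j}{2^n}(s-r)$ for $0\le j\le 2^n$, $n\ge 0$; $V^s_{r,n}=\{t_{nj}:0<j<2^n\}$ for $n\ge1$; $V^s_r=\bigcup_{n\ge1}V^s_{r,n}$; $\Omega^s_r=[0,1]^{V^s_r}$; $\hat V^s_r=V^s_r\cup\{s\}$, $\hat\Omega^s_r=[0,1]^{\hat V^s_r}$. The map $\hat\pi:\hat\Omega^s_r\to\Omega^s_r$ is restriction of coordinates to $V^s_r$. Let $\Lambda^s_r$ be the set of continuous $x:[r,s]\to\mathbb{R}$ with $|x(v)-x(u)|\le c|v-u|$ for all $u,v\in[r,s]$; $\Lambda^{s,b}_{r,a}=\{x\in\Lambda^s_r: x(r)=a,\ x(s)=b\}$, $\Lambda^s_{r,a}=\{x\in\Lambda^s_r:x(r)=a\}$. Let $C_r$ be the set of continuous functions $x:[r,+\infty)\to\mathbb{R}$, $\Lambda_r=\{x\in C_r:|x(v)-x(u)|\le c|v-u|\text{ for all }u,v\in[r,+\infty)\}$, $\Lambda_{r,a}=\{x\in\Lambda_r:x(r)=a\}$.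 Definition of $\varphi^{s,b}_{r,a}:\Omega^s_r\to\Lambda^{s,b}_{r,a}$ (when $P^{s,b}_{r,a}\neq\emptyset$): for $\omega\in\Omega^s_r$, the function $\varphi(\omega)=\varphi^{s,b}_{r,a}(\omega)$ is defined on $V^s_r\cup\{r,s\}$ recursively by $\varphi(\omega)(r)=a$, $\varphi(\omega)(s)=b$, and, for $m\ge1$ and $1\le j\le 2^{m-1}$, writing $a_{m-1,i}=\varphi(\omega)(t_{m-1,i})$, $$\varphi(\omega)(t_{m,2j-1})=\lambda^{t_{m-1,j},a_{m-1,j}}_{t_{m-1,j-1},a_{m-1,j-1}}(\omega_{t_{m,2j-1}})$$ (at each step the relevant set $P^{t_{m-1,j},a_{m-1,j}}_{t_{m-1,j-1},a_{m-1,j-1}}$ is nonempty, and $t_{m,2j}=t_{m-1,j}$). The resulting function is $c$-Lipschitz on the dense set $V^s_r\cup\{r,s\}$ and $\varphi^{s,b}_{r,a}(\omega)\in\Lambda^{s,b}_{r,a}$ denotes its unique continuous extension to $[r,s]$. Definition of $\varphi^s_{r,a}:\hat\Omega^s_r\to\Lambda^s_{r,a}$: $\varphi^s_{r,a}(\hat\omega)=\varphi^{s,b}_{r,a}(\hat\pi(\hat\omega))$ with $b=\lambda^s_{r,a}(\hat\omega_s)$. Definition of $\varphi_{r,a}$: let $r\ge0$ and let $m$ be the smallest integer with $m>r$. Let $\hat V_r=\hat V^m_r\cup\bigcup_{j=m}^\infty\hat V^{j+1}_j$ and $\hat\Omega_r=[0,1]^{\hat V_r}$ with the product topology. For $\hat\omega\in\hat\Omega_r$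 let $\hat\pi_{r,m}(\hat\omega)\in\hat\Omega^m_r$ and $\hat\pi_{j,j+1}(\hat\omega)\in\hat\Omega^{j+1}_j$ ($j\ge m$) be the restrictions of $\hat\omega$ to $\hat V^m_r$ and $\hat V^{j+1}_j$. For $a\in\mathbb{R}$, $\varphi_{r,a}(\hat\omega)\in\Lambda_{r,a}$ is the function given on $[r,m]$ by $\varphi^m_{r,a}(\hat\pi_{r,m}(\hat\omega))$ and, inductively for $j\ge m$, on $[j,j+1]$ by $\varphi^{j+1}_{j,d}(\hat\pi_{j,j+1}(\hat\omega))$ with $d=\varphi_{r,a}(\hat\omega)(j)$. *)

theory Defs
  imports "HOL-Analysis.Analysis"
begin

text \<open>
  Points of the plane are pairs (time, position).  In all definitions below the argument order
  follows the flow of time: initial time \<open>r\<close>, initial position \<open>a\<close>, final time \<open>s\<close>, final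
  position \<open>b\<close>.  Functions on a subset \<open>S\<close> of the reals are elements of \<^term>\<open>extensional S\<close>.
  The given parametrizations of the intervals \<open>mid_interval c r a s b\<close> and \<open>end_interval c r a s\<close> by
  \<open>\<xi> \<in> [0, 1]\<close> are total functions \<open>lam r a s b \<xi>\<close> and \<open>mu r a s \<xi>\<close>; they are constrained only
  for \<open>0 \<le> r < s\<close>, \<open>\<xi> \<in> [0, 1]\<close> and, for \<open>lam\<close>, a nonempty parallelogram.
\<close>

definition forward_cone :: "real \<Rightarrow> real \<Rightarrow> real \<Rightarrow> (real \<times> real) set" where
  "forward_cone c r a = {(t, x). r \<le> t \<and> a - c * (t - r) \<le> x \<and> x \<le> a + c * (t - r)}"

definition backward_cone :: "real \<Rightarrow> real \<Rightarrow> real \<Rightarrow> (real \<times> real) set" where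
  "backward_cone c s b = {(t, x). t \<le> s \<and> b - c * (s - t) \<le> x \<and> x \<le> b + c * (s - t)}"

definition parallelogram :: "real \<Rightarrow> real \<Rightarrow> real \<Rightarrow> real \<Rightarrow> real \<Rightarrow> (real \<times> real) set" where
  "parallelogram c r a s b = forward_cone c r a \<inter> backward_cone c s b"

definition mid_interval :: "real \<Rightarrow> real \<Rightarrow> real \<Rightarrow> real \<Rightarrow> real \<Rightarrow> real set" where
  "mid_interval c r a s b = {x. ((r + s) / 2, x) \<in> parallelogram c r a s b}"

definition end_interval :: "real \<Rightarrow> real \<Rightarrow> real \<Rightarrow> real \<Rightarrow> real set" where
  "end_interval c r a s = {a - c * (s - r) .. a + c * (s - r)}"

definition dyadic_point :: "real \<Rightarrow> real \<Rightarrow> nat \<Rightarrow> nat \<Rightarrow> real" where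
  "dyadic_point r s n j = r + real j / 2 ^ n * (s - r)"

definition dyadic_level :: "real \<Rightarrow> real \<Rightarrow> nat \<Rightarrow> real set" where
  "dyadic_level r s n = {dyadic_point r s n j | j. 0 < j \<and> j < 2 ^ n}"

definition dyadics :: "real \<Rightarrow> real \<Rightarrow> real set" where
  "dyadics r s = (\<Union>n\<in>{1..}. dyadic_level r s n)"

definition dyadics_end :: "real \<Rightarrow> real \<Rightarrow> real set" where
  "dyadics_end r s = dyadics r s \<union> {s}"

text \<open>
  \<open>grid_value lam r a s b \<omega> n j\<close> is the value at \<^term>\<open>dyadic_point r s n j\<close>, for \<open>j \<le> 2 ^ n\<close>, of
  the path from \<open>(r, a)\<close> to \<open>(s, b)\<close> with parameter \<open>\<omega>\<close>.  Even points of level \<open>m + 1\<close> are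
  points of level \<open>m\<close>; an odd point is the midpoint of the two level \<open>m\<close> points
  with indices \<open>j div 2\<close> and \<open>j div 2 + 1\<close>.
\<close>

primrec grid_value ::
  "(real \<Rightarrow> real \<Rightarrow> real \<Rightarrow> real \<Rightarrow> real \<Rightarrow> real) \<Rightarrow> real \<Rightarrow> real \<Rightarrow> real \<Rightarrow> real \<Rightarrow>
   (real \<Rightarrow> real) \<Rightarrow> nat \<Rightarrow> nat \<Rightarrow> real" where
  "grid_value lam r a s b \<omega> 0 j = (if j = 0 then a else b)"
| "grid_value lam r a s b \<omega> (Suc m) j =
     (if even j then grid_value lam r a s b \<omega> m (j div 2)
      else lam (dyadic_point r s m (j div 2)) (grid_value lam r a s b \<omega> m (j div 2))
               (dyadic_point r s m (j div 2 + 1)) (grid_value lam r a s b \<omega> m (j div 2 + 1))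
               (\<omega> (dyadic_point r s (Suc m) j)))"

text \<open>The unique continuous extension of the grid values to \<open>[r, s]\<close>.\<close>

definition bridge_path ::
  "(real \<Rightarrow> real \<Rightarrow> real \<Rightarrow> real \<Rightarrow> real \<Rightarrow> real) \<Rightarrow> real \<Rightarrow> real \<Rightarrow> real \<Rightarrow> real \<Rightarrow>
   (real \<Rightarrow> real) \<Rightarrow> real \<Rightarrow> real" where
  "bridge_path lam r a s b \<omega> =
     (THE x. x \<in> extensional {r..s} \<and> continuous_on {r..s} x \<and>
        (\<forall>n j. j \<le> 2 ^ n \<longrightarrow> x (dyadic_point r s n j) = grid_value lam r a s b \<omega> n j))"

definition free_path ::
  "(real \<Rightarrow> real \<Rightarrow> real \<Rightarrow> real \<Rightarrow> real \<Rightarrow> real) \<Rightarrow> (real \<Rightarrow> real \<Rightarrow> real \<Rightarrow> real \<Rightarrow> real) \<Rightarrow>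
   real \<Rightarrow> real \<Rightarrow> real \<Rightarrow> (real \<Rightarrow> real) \<Rightarrow> real \<Rightarrow> real" where
  "free_path lam mu r a s \<omega> =
     bridge_path lam r a s (mu r a s (\<omega> s)) (restrict \<omega> (dyadics r s))"

text \<open>For \<open>r \<ge> 0\<close> the smallest integer greater than \<open>r\<close> is a positive natural number.\<close>

definition next_nat :: "real \<Rightarrow> nat" where
  "next_nat r = (LEAST m. r < real m)"

definition ray_index :: "real \<Rightarrow> real set" where
  "ray_index r = dyadics_end r (real (next_nat r)) \<union>
     (\<Union>j\<in>{next_nat r..}. dyadics_end (real j) (real (j + 1)))"

definition ray_parameters :: "real \<Rightarrow> (real \<Rightarrow> real) topology" where
  "ray_parameters r = product_topology (\<lambda>_. top_of_set {0..1::real}) (ray_index r)"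

text \<open>
  With \<open>m = next_nat r\<close>, \<open>ray_segment lam mu r a \<omega> k\<close> is the restriction to \<open>[r, m + k]\<close> of the
  path on \<open>[r, \<infinity>)\<close> with parameter \<open>\<omega>\<close>.
\<close>

primrec ray_segment ::
  "(real \<Rightarrow> real \<Rightarrow> real \<Rightarrow> real \<Rightarrow> real \<Rightarrow> real) \<Rightarrow> (real \<Rightarrow> real \<Rightarrow> real \<Rightarrow> real \<Rightarrow> real) \<Rightarrow>
   real \<Rightarrow> real \<Rightarrow> (real \<Rightarrow> real) \<Rightarrow> nat \<Rightarrow> real \<Rightarrow> real" where
  "ray_segment lam mu r a \<omega> 0 =
     free_path lam mu r a (real (next_nat r)) (restrict \<omega> (dyadics_end r (real (next_nat r))))"
| "ray_segment lam mu r a \<omega> (Suc k) =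
     (let j = next_nat r + k; x = ray_segment lam mu r a \<omega> k in
      (\<lambda>t\<in>{r..real (j + 1)}.
        if t \<le> real j then x t
        else free_path lam mu (real j) (x (real j)) (real (j + 1))
               (restrict \<omega> (dyadics_end (real j) (real (j + 1)))) t))"

definition ray_path ::
  "(real \<Rightarrow> real \<Rightarrow> real \<Rightarrow> real \<Rightarrow> real \<Rightarrow> real) \<Rightarrow> (real \<Rightarrow> real \<Rightarrow> real \<Rightarrow> real \<Rightarrow> real) \<Rightarrow>
   real \<Rightarrow> real \<Rightarrow> (real \<Rightarrow> real) \<Rightarrow> real \<Rightarrow> real" where
  "ray_path lam mu r a \<omega> =
     (\<lambda>t\<in>{r..}. ray_segment lam mu r a \<omega> (LEAST k. t \<le> real (next_nat r + k)) t)"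

definition continuous_rays :: "real \<Rightarrow> (real \<Rightarrow> real) set" where
  "continuous_rays r = {x \<in> extensional {r..}. continuous_on {r..} x}"

definition lipschitz_rays :: "real \<Rightarrow> real \<Rightarrow> (real \<Rightarrow> real) set" where
  "lipschitz_rays c r =
     {x \<in> continuous_rays r. \<forall>u\<in>{r..}. \<forall>v\<in>{r..}. \<bar>x v - x u\<bar> \<le> c * \<bar>v - u\<bar>}"

definition lipschitz_rays_from :: "real \<Rightarrow> real \<Rightarrow> real \<Rightarrow> (real \<Rightarrow> real) set" where
  "lipschitz_rays_from c r a = {x \<in> lipschitz_rays c r. x r = a}"

definition compact_open_topology :: "'a topology \<Rightarrow> 'b topology \<Rightarrow> ('a \<Rightarrow> 'b) topology" where
  "compact_open_topology X Y = topology_generated_by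
     {{f \<in> extensional (topspace X). continuous_map X Y f \<and> f ` K \<subseteq> U} | K U.
        compactin X K \<and> openin Y U}"

definition ray_topology :: "real \<Rightarrow> (real \<Rightarrow> real) topology" where
  "ray_topology r = compact_open_topology (top_of_set {r..}) euclideanreal"

lemma topspace_ray_topology: "topspace (ray_topology r) = continuous_rays r"
proof -
  have "compactin (top_of_set {r..}) {}" "openin euclideanreal UNIV"
    by auto
  then show ?thesis
    unfolding ray_topology_def compact_open_topology_def continuous_rays_def
      topology_generated_by_topspace
    by (auto 4 4)
qed

end

theory Submission
  imports Defs
begin

text \<open>
  All paths in question are \<open>c\<close>-Lipschitz, whatever the starting point and the parameter.  For a
  family with a common Lipschitz constant, continuity in the compact-open topology reduces to
  continuity of the evaluations at single times
  (\<open>continuous_map_into_ray_topology\<close>), and continuity of the evaluations at a dense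
  set of times already gives it at all times (\<open>equilipschitz_continuous_at_closure\<close>).
  Both follow from \<open>equilipschitz_locally_uniform\<close>.

  It therefore suffices to look at the path at a dyadic time.  There its value is obtained from the
  two end values and finitely many coordinates of the parameter by finitely many applications
  of \<open>lam\<close>, so joint continuity of \<open>lam\<close> makes it continuous
  (\<open>continuous_map_grid_value\<close>).  The inductive hypothesis has to include the speed bound
  (\<open>grid_value_step\<close>), since \<open>lam\<close> is known to be continuous only where the parallelogram
  is nonempty.  The same bound makes the values on the dyadic grid Lipschitz, so they extend to the
  whole interval (\<open>bridge_path_works\<close>).

  Joint continuity of \<open>mu\<close> then lets the right end vary (\<open>continuous_map_free_path\<close>).
  A ray is a concatenation of such paths over consecutive intervals, the first ending at the next
  integer and the others of length one, so only finitely many are needed up to any given time.  An induction over these intervals, in which the end of one path is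
  the start of the next, gives the Lipschitz bound and the continuity of each evaluation.

  Continuity is proved throughout for starting points and parameters that depend
  continuously on a point \<open>z\<close> of an arbitrary topological space.  This is what the induction
  needs, where the start of each later piece is itself a function of all the data, and it covers both
  the joint statement and the one for a fixed starting point.
\<close>

section \<open>Families of functions with a common Lipschitz constant\<close>

text \<open>The Arzela--Ascoli mechanism: \<open>K\<close> is covered by finitely many small balls around
  points of \<open>D\<close>, so finitely many evaluations control the whole family on \<open>K\<close>.\<close>

lemma equilipschitz_locally_uniform:
  fixes F :: "'z \<Rightarrow> 'a::metric_space \<Rightarrow> 'b::metric_space"
  assumes lip: "\<And>z. z \<in> topspace Z \<Longrightarrow> L-lipschitz_on (closure D) (F z)"
    and cont: "\<And>t. t \<in> D \<Longrightarrow> continuous_map Z euclidean (\<lambda>z. F z t)"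
    and K: "compact K" "K \<subseteq> closure D"
    and z0: "z0 \<in> topspace Z" and "e > 0"
  obtains N where "openin Z N" "z0 \<in> N"
    "\<And>z t. z \<in> N \<Longrightarrow> t \<in> K \<Longrightarrow> dist (F z t) (F z0 t) < e"
proof -
  have L: "0 \<le> L"
    using lip[OF z0] by (rule lipschitz_on_nonneg)
  \<comment> \<open>Moving from \<open>t\<close> to a centre \<open>q\<close> within \<open>d\<close> costs less than \<open>e/4\<close>, and it is done twice;
    the remaining \<open>e/2\<close> is for the change of \<open>z\<close> at \<open>q\<close>.  The \<open>+ 1\<close> makes \<open>L * d < e / 4\<close> strict
    and covers \<open>L = 0\<close>.\<close>
  define d where "d = e / (4 * (L + 1))"
  have d: "d > 0" and Ld: "L * d < e / 4"
    using L \<open>e > 0\<close> by (auto simp: d_def field_simps)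
  have "K \<subseteq> (\<Union>q\<in>D. ball q d)"
    using K(2) d by (force simp: closure_approachable subset_iff)
  then obtain D' where D': "D' \<subseteq> D" "finite D'" "K \<subseteq> (\<Union>q\<in>D'. ball q d)"
    using compactE_image[OF K(1), of D "\<lambda>q. ball q d"] by auto
  define W where "W q = {z \<in> topspace Z. F z q \<in> ball (F z0 q) (e/2)}" for q
  define N where "N = topspace Z \<inter> \<Inter>(W ` D')"
  have "openin Z (W q)" if "q \<in> D'" for q
    unfolding W_def using cont[of q] that D'(1)
    by (intro openin_continuous_map_preimage) auto
  then have "openin Z N"
    unfolding N_def using D'(2) by (intro openin_Int_Inter) auto
  moreover have "z0 \<in> N"
    using z0 \<open>e > 0\<close> by (auto simp: N_def W_def)
  moreover have "dist (F z t) (F z0 t) < e" if zN: "z \<in> N" and tK: "t \<in> K" for z t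
  proof -
    obtain q where q: "q \<in> D'" "dist q t < d"
      using D'(3) tK by auto
    have tq: "t \<in> closure D" "q \<in> closure D"
      using K(2) tK q(1) D'(1) closure_subset by blast+
    have *: "dist (F w t) (F w q) < e / 4" if "w \<in> topspace Z" for w
    proof -
      have "dist (F w t) (F w q) \<le> L * dist t q"
        using lipschitz_onD[OF lip[OF that] tq] .
      also have "\<dots> \<le> L * d"
        using q(2) L by (intro mult_left_mono) (auto simp: dist_commute)
      finally show ?thesis using Ld by simp
    qed
    have z: "z \<in> topspace Z" "dist (F z0 q) (F z q) < e / 2"
      using zN q(1) by (auto simp: N_def W_def)
    have "dist (F z t) (F z0 t) \<le> dist (F z t) (F z q) + dist (F z q) (F z0 q) + dist (F z0 q) (F z0 t)"
      by (metis add.commute add_left_mono dist_triangle order_trans)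
    then show ?thesis
      using *[OF z(1)] *[OF z0] z(2) by (simp add: dist_commute)
  qed
  ultimately show ?thesis using that by blast
qed

text \<open>The preceding lemma for a one-point set \<open>K\<close>.  It turns continuity at dyadic
  times into continuity at all times.\<close>

lemma equilipschitz_continuous_at_closure:
  fixes F :: "'z \<Rightarrow> 'a::metric_space \<Rightarrow> 'b::metric_space"
  assumes lip: "\<And>z. z \<in> topspace Z \<Longrightarrow> L-lipschitz_on (closure D) (F z)"
    and cont: "\<And>t. t \<in> D \<Longrightarrow> continuous_map Z euclidean (\<lambda>z. F z t)"
    and t: "t \<in> closure D"
  shows "continuous_map Z euclidean (\<lambda>z. F z t)"
proof -
  have "\<exists>N. openin Z N \<and> z0 \<in> N \<and> (\<forall>z\<in>N. F z t \<in> ball (F z0 t) e)"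
    if "z0 \<in> topspace Z" "e > 0" for z0 e
    using equilipschitz_locally_uniform[of Z L D F "{t}" z0 e] lip cont t that
    by (simp add: dist_commute) (metis dist_commute)
  then show ?thesis
    using Met_TC.continuous_map_to_metric[of Z "\<lambda>z. F z t"] by simp
qed

lemma lipschitz_rays_iff:
  assumes "c \<ge> 0"
  shows "x \<in> lipschitz_rays c r \<longleftrightarrow> x \<in> extensional {r..} \<and> c-lipschitz_on {r..} x"
proof -
  have "c-lipschitz_on {r..} x \<longleftrightarrow> (\<forall>u\<in>{r..}. \<forall>v\<in>{r..}. \<bar>x v - x u\<bar> \<le> c * \<bar>v - u\<bar>)"
    using assms unfolding lipschitz_on_def dist_real_def by blast
  then show ?thesis
    unfolding lipschitz_rays_def continuous_rays_def
    using lipschitz_on_continuous_on by blast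
qed

text \<open>If the image of a compact set \<open>K\<close> lies in an open set \<open>U\<close>, so does some
  \<open>e\<close>-neighbourhood of that image, so \<open>e\<close>-closeness on \<open>K\<close>, which holds locally in \<open>z\<close>, preserves the
  subbasic condition.\<close>

lemma continuous_map_into_ray_topology:
  assumes "c \<ge> 0"
    and ray: "\<And>z. z \<in> topspace Z \<Longrightarrow> F z \<in> lipschitz_rays c r"
    and cont: "\<And>t. t \<ge> r \<Longrightarrow> continuous_map Z euclideanreal (\<lambda>z. F z t)"
  shows "continuous_map Z (ray_topology r) F"
  unfolding ray_topology_def compact_open_topology_def
proof (rule continuous_on_generated_topo)
  have lip: "c-lipschitz_on {r..} (F z)" if "z \<in> topspace Z" for z
    using ray[OF that] lipschitz_rays_iff[OF \<open>c \<ge> 0\<close>] by blast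
  have rays: "F z \<in> continuous_rays r" if "z \<in> topspace Z" for z
    using ray[OF that] by (simp add: lipschitz_rays_def)
  show "F ` topspace Z \<subseteq> \<Union> {{f \<in> extensional (topspace (top_of_set {r..})).
      continuous_map (top_of_set {r..}) euclideanreal f \<and> f ` K \<subseteq> U} |K U.
      compactin (top_of_set {r..}) K \<and> openin euclideanreal U}"
    using rays topspace_ray_topology[of r]
    unfolding ray_topology_def compact_open_topology_def topology_generated_by_topspace by blast
  fix W
  assume "W \<in> {{f \<in> extensional (topspace (top_of_set {r..})).
      continuous_map (top_of_set {r..}) euclideanreal f \<and> f ` K \<subseteq> U} |K U.
      compactin (top_of_set {r..}) K \<and> openin euclideanreal U}"
  then obtain K U where K: "compact K" "K \<subseteq> {r..}" and U: "open U"
    and W: "W = {f \<in> continuous_rays r. f ` K \<subseteq> U}"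
    by (auto simp: compactin_subtopology continuous_rays_def)
  show "openin Z (F -` W \<inter> topspace Z)"
  proof (subst openin_subopen, intro ballI)
    fix z0 assume "z0 \<in> F -` W \<inter> topspace Z"
    then have z0: "z0 \<in> topspace Z" "F z0 ` K \<subseteq> U"
      by (auto simp: W)
    have "compact (F z0 ` K)"
      using lipschitz_on_continuous_on[OF lip[OF z0(1)]] K
      by (meson compact_continuous_image continuous_on_subset)
    then obtain e where e: "e > 0" "(\<Union>y\<in>F z0 ` K. ball y e) \<subseteq> U"
      using compact_subset_open_imp_ball_epsilon_subset U z0(2) by metis
    obtain N where N: "openin Z N" "z0 \<in> N"
      "\<And>z t. z \<in> N \<Longrightarrow> t \<in> K \<Longrightarrow> dist (F z t) (F z0 t) < e"
      using equilipschitz_locally_uniform[of Z c "{r..}" F K z0 e] lip cont K z0(1) e(1)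
      by (auto simp: closure_closed)
    have "N \<subseteq> topspace Z"
      by (rule openin_subset[OF N(1)])
    moreover have "F z ` K \<subseteq> U" if "z \<in> N" for z
    proof
      fix y assume "y \<in> F z ` K"
      then obtain t where "t \<in> K" "y = F z t" by blast
      then show "y \<in> U"
        using N(3)[OF that, of t] e(2) by (force simp: dist_commute)
    qed
    ultimately show "\<exists>T. openin Z T \<and> z0 \<in> T \<and> T \<subseteq> F -` W \<inter> topspace Z"
      using N(1,2) rays by (intro exI[of _ N]) (auto simp: W)
  qed
qed

lemma continuous_map_euclidean_pairI:
  assumes "continuous_map Z euclidean f" "continuous_map Z euclidean g"
  shows "continuous_map Z euclidean (\<lambda>z. (f z, g z))"
  using continuous_map_pairedI[OF assms] by simp

section \<open>Dyadic points\<close>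

lemma dyadic_point_in_dyadics:
  assumes "0 < j" "j < 2 ^ n"
  shows "dyadic_point r s n j \<in> dyadics r s"
proof -
  have "n \<noteq> 0" using assms by (cases n) auto
  then show ?thesis
    using assms unfolding dyadics_def dyadic_level_def by force
qed

lemma dyadic_point_refine: "dyadic_point r s (n + k) (j * 2 ^ k) = dyadic_point r s n j"
  by (simp add: dyadic_point_def power_add)

lemma dyadic_point_diff:
  "dyadic_point r s n k - dyadic_point r s n j = (real k - real j) * ((s - r) / 2 ^ n)"
  by (simp add: dyadic_point_def algebra_simps diff_divide_distrib)

lemma dyadic_point_bounds:
  assumes "r < s" "j \<le> 2 ^ n"
  shows "r \<le> dyadic_point r s n j" "dyadic_point r s n j \<le> s"
proof -
  have "real j / 2 ^ n \<le> 1"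
    using assms(2) by (simp add: divide_le_eq_1)
  then have "real j / 2 ^ n * (s - r) \<le> 1 * (s - r)"
    using assms(1) by (intro mult_right_mono) auto
  then show "dyadic_point r s n j \<le> s"
    by (simp add: dyadic_point_def)
  show "r \<le> dyadic_point r s n j"
    using assms(1) by (simp add: dyadic_point_def)
qed

definition dyadic_grid :: "real \<Rightarrow> real \<Rightarrow> real set" where
  "dyadic_grid r s = {dyadic_point r s n j | n j. j \<le> 2 ^ n}"

lemma closure_dyadic_grid:
  assumes "r < s"
  shows "closure (dyadic_grid r s) = {r..s}"
proof (rule antisym)
  show "closure (dyadic_grid r s) \<subseteq> {r..s}"
    using dyadic_point_bounds[OF assms]
    by (intro closure_minimal) (auto simp: dyadic_grid_def)
  show "{r..s} \<subseteq> closure (dyadic_grid r s)"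
  proof
    fix t assume t: "t \<in> {r..s}"
    show "t \<in> closure (dyadic_grid r s)"
      unfolding closure_approachable
    proof (intro allI impI)
      fix e :: real assume "e > 0"
      then obtain n where n: "(1/2) ^ n < e / (s - r)"
        using assms real_arch_pow_inv[of "e / (s - r)" "1/2"] by auto
      then have n: "(s - r) / 2 ^ n < e"
        using assms by (simp add: power_divide field_simps)
      \<comment> \<open>\<open>q\<close> is the position of \<open>t\<close> measured in grid steps; rounding it down keeps \<open>j \<le> 2 ^ n\<close> even
        for \<open>t = s\<close>.\<close>
      define q where "q = (t - r) / (s - r) * 2 ^ n"
      define j where "j = nat \<lfloor>q\<rfloor>"
      have "(t - r) / (s - r) \<le> 1"
        using t assms by (simp add: divide_le_eq_1)
      then have q: "0 \<le> q" "q \<le> 2 ^ n"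
        using t assms mult_right_mono[of "(t - r) / (s - r)" 1 "2 ^ n"] by (auto simp: q_def)
      have j: "real j \<le> q" "q < real j + 1"
        using q(1) unfolding j_def by linarith+
      have "real j \<le> real (2 ^ n)"
        using j(1) q(2) unfolding of_nat_power of_nat_numeral by linarith
      then have "j \<le> 2 ^ n"
        unfolding of_nat_le_iff .
      then have "dyadic_point r s n j \<in> dyadic_grid r s"
        by (auto simp: dyadic_grid_def)
      moreover have "t = r + q / 2 ^ n * (s - r)"
        using assms by (simp add: q_def)
      then have "t - dyadic_point r s n j = (q - real j) * ((s - r) / 2 ^ n)"
        by (simp add: dyadic_point_def algebra_simps diff_divide_distrib)
      then have "\<bar>t - dyadic_point r s n j\<bar> \<le> 1 * ((s - r) / 2 ^ n)"
        using j assms by (simp only: abs_mult) (intro mult_mono; simp)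
      ultimately show "\<exists>y\<in>dyadic_grid r s. dist y t < e"
        using n by (intro bexI[of _ "dyadic_point r s n j"]) (auto simp: dist_real_def)
    qed
  qed
qed

lemma grid_value_refine:
  "grid_value lam r a s b \<omega> (n + k) (j * 2 ^ k) = grid_value lam r a s b \<omega> n j"
proof (induction k)
  case (Suc k)
  have "grid_value lam r a s b \<omega> (Suc (n + k)) (2 * (j * 2 ^ k)) = grid_value lam r a s b \<omega> n j"
    using Suc by simp
  then show ?case by (simp only: power_Suc add_Suc_right mult.left_commute)
qed simp

section \<open>Paths with speed at most the given constant\<close>

locale speed_bounded_choices =
  fixes c :: real
    and lam :: "real \<Rightarrow> real \<Rightarrow> real \<Rightarrow> real \<Rightarrow> real \<Rightarrow> real"
    and mu :: "real \<Rightarrow> real \<Rightarrow> real \<Rightarrow> real \<Rightarrow> real"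
  assumes c_pos: "c > 0"
    and lam_image: "\<And>r a s b. 0 \<le> r \<Longrightarrow> r < s \<Longrightarrow> parallelogram c r a s b \<noteq> {} \<Longrightarrow>
           lam r a s b ` {0..1} = mid_interval c r a s b"
    and lam_continuous: "continuous_on
           {(a, b, r, s, \<xi>). 0 \<le> r \<and> r < s \<and> \<bar>b - a\<bar> \<le> c * (s - r) \<and> \<xi> \<in> {0..1}}
           (\<lambda>(a, b, r, s, \<xi>). lam r a s b \<xi>)"
    and mu_image: "\<And>r a s. 0 \<le> r \<Longrightarrow> r < s \<Longrightarrow> mu r a s ` {0..1} = end_interval c r a s"
    and mu_continuous: "continuous_on {(a, r, s, \<xi>). 0 \<le> r \<and> r < s \<and> \<xi> \<in> {0..1}}
           (\<lambda>(a, r, s, \<xi>). mu r a s \<xi>)"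
begin

lemma lam_halfway:
  assumes "0 \<le> r" "r < s" "\<bar>b - a\<bar> \<le> c * (s - r)" "\<xi> \<in> {0..1}"
  shows "\<bar>lam r a s b \<xi> - a\<bar> \<le> c * ((s - r) / 2)"
    and "\<bar>b - lam r a s b \<xi>\<bar> \<le> c * ((s - r) / 2)"
proof -
  \<comment> \<open>The left corner witnesses that the parallelogram is nonempty.\<close>
  have "(r, a) \<in> parallelogram c r a s b"
    using assms by (auto simp: parallelogram_def forward_cone_def backward_cone_def)
  then have "lam r a s b \<xi> \<in> mid_interval c r a s b"
    using lam_image[of r s a b] assms by blast
  then have "a - c * ((r + s) / 2 - r) \<le> lam r a s b \<xi>" "lam r a s b \<xi> \<le> a + c * ((r + s) / 2 - r)"
    "b - c * (s - (r + s) / 2) \<le> lam r a s b \<xi>" "lam r a s b \<xi> \<le> b + c * (s - (r + s) / 2)"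
    by (simp_all add: mid_interval_def parallelogram_def forward_cone_def backward_cone_def)
  moreover have "(r + s) / 2 - r = (s - r) / 2" "s - (r + s) / 2 = (s - r) / 2"
    by (simp_all add: field_simps)
  ultimately show "\<bar>lam r a s b \<xi> - a\<bar> \<le> c * ((s - r) / 2)" "\<bar>b - lam r a s b \<xi>\<bar> \<le> c * ((s - r) / 2)"
    by (simp_all only: abs_le_iff) linarith+
qed

lemma mu_bound:
  assumes "0 \<le> r" "r < s" "\<xi> \<in> {0..1}"
  shows "\<bar>mu r a s \<xi> - a\<bar> \<le> c * (s - r)"
proof -
  have "mu r a s \<xi> \<in> end_interval c r a s"
    using mu_image[of r s a] assms by blast
  then show ?thesis by (auto simp: end_interval_def)
qed

lemma continuous_map_lam:
  assumes "0 \<le> r" "r < s"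
    and "continuous_map Z euclideanreal a" "continuous_map Z euclideanreal b"
    and "\<And>z. z \<in> topspace Z \<Longrightarrow> \<bar>b z - a z\<bar> \<le> c * (s - r)"
    and "continuous_map Z (top_of_set {0..1}) \<xi>"
  shows "continuous_map Z euclideanreal (\<lambda>z. lam r (a z) s (b z) (\<xi> z))"
proof -
  let ?S = "{(a, b, r, s, \<xi>). 0 \<le> r \<and> r < s \<and> \<bar>b - a\<bar> \<le> c * (s - r) \<and> \<xi> \<in> {0..1}}"
  have \<xi>: "continuous_map Z euclideanreal \<xi>" "\<And>z. z \<in> topspace Z \<Longrightarrow> \<xi> z \<in> {0..1}"
    using assms(6) by (auto simp: continuous_map_in_subtopology)
  have "continuous_map Z euclidean (\<lambda>z. (a z, b z, r, s, \<xi> z))"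
    using assms(3,4) \<xi>(1)
    by (intro continuous_map_euclidean_pairI) auto
  then have "continuous_map Z (top_of_set ?S) (\<lambda>z. (a z, b z, r, s, \<xi> z))"
    using assms(1,2,5) \<xi>(2) by (intro continuous_map_into_subtopology) auto
  from continuous_map_compose[OF this lam_continuous[folded continuous_map_iff_continuous]]
  show ?thesis by (simp add: o_def)
qed

lemma continuous_map_mu:
  assumes "0 \<le> r" "r < s" "continuous_map Z euclideanreal a"
    and "continuous_map Z (top_of_set {0..1}) \<xi>"
  shows "continuous_map Z euclideanreal (\<lambda>z. mu r (a z) s (\<xi> z))"
proof -
  let ?S = "{(a, r, s, \<xi>). 0 \<le> r \<and> r < s \<and> \<xi> \<in> {0..1}}"
  have \<xi>: "continuous_map Z euclideanreal \<xi>" "\<And>z. z \<in> topspace Z \<Longrightarrow> \<xi> z \<in> {0..1}"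
    using assms(4) by (auto simp: continuous_map_in_subtopology)
  have "continuous_map Z euclidean (\<lambda>z. (a z, r, s, \<xi> z))"
    using assms(3) \<xi>(1)
    by (intro continuous_map_euclidean_pairI) auto
  then have "continuous_map Z (top_of_set ?S) (\<lambda>z. (a z, r, s, \<xi> z))"
    using assms(1,2) \<xi>(2) by (intro continuous_map_into_subtopology) auto
  from continuous_map_compose[OF this mu_continuous[folded continuous_map_iff_continuous]]
  show ?thesis by (simp add: o_def)
qed

section \<open>Bridges between two points\<close>

text \<open>The choice made at the midpoint of a dyadic interval stays in the parallelogram of that
  interval, so both halves inherit the speed bound.  This also keeps every parallelogram of the
  recursion nonempty.\<close>

lemma grid_value_step:
  assumes "0 \<le> r" "r < s" "\<bar>b - a\<bar> \<le> c * (s - r)" "\<omega> \<in> dyadics r s \<rightarrow> {0..1}" "j < 2 ^ n"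
  shows "\<bar>grid_value lam r a s b \<omega> n (Suc j) - grid_value lam r a s b \<omega> n j\<bar> \<le> c * ((s - r) / 2 ^ n)"
  using assms(5)
proof (induction n arbitrary: j)
  case 0
  then show ?case using assms(3) by simp
next
  case (Suc n)
  define i where "i = j div 2"
  have i: "i < 2 ^ n"
    using Suc.prems by (auto simp: i_def)
  let ?g = "grid_value lam r a s b \<omega>" and ?t = "dyadic_point r s"
  let ?y = "lam (?t n i) (?g n i) (?t n (i + 1)) (?g n (i + 1)) (\<omega> (?t (Suc n) (2 * i + 1)))"
  have "0 \<le> ?t n i"
    using dyadic_point_bounds(1)[of r s i n] assms(1,2) i by simp
  moreover have len: "?t n (i + 1) - ?t n i = (s - r) / 2 ^ n"
    by (simp add: dyadic_point_diff)
  then have "?t n i < ?t n (i + 1)"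
    using assms(2) by (metis diff_gt_0_iff_gt divide_pos_pos zero_less_numeral zero_less_power)
  moreover have "\<bar>?g n (i + 1) - ?g n i\<bar> \<le> c * (?t n (i + 1) - ?t n i)"
    using Suc.IH[OF i] by (simp only: len Suc_eq_plus1)
  moreover have "\<omega> (?t (Suc n) (2 * i + 1)) \<in> {0..1}"
    using assms(4) i by (intro Pi_mem[OF assms(4)] dyadic_point_in_dyadics) auto
  ultimately have half:
    "\<bar>?y - ?g n i\<bar> \<le> c * ((?t n (i + 1) - ?t n i) / 2)"
    "\<bar>?g n (i + 1) - ?y\<bar> \<le> c * ((?t n (i + 1) - ?t n i) / 2)"
    by (rule lam_halfway)+
  have len': "(?t n (i + 1) - ?t n i) / 2 = (s - r) / 2 ^ Suc n"
    unfolding len by simp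
  show ?case
  proof (cases "even j")
    case True
    then have "j = 2 * i" by (simp add: i_def)
    then show ?thesis using half(1)[unfolded len'] by simp
  next
    case False
    then have "j = 2 * i + 1" by (simp add: i_def)
    then show ?thesis using half(2)[unfolded len'] by simp
  qed
qed

lemma grid_value_lipschitz_same_level:
  assumes "0 \<le> r" "r < s" "\<bar>b - a\<bar> \<le> c * (s - r)" "\<omega> \<in> dyadics r s \<rightarrow> {0..1}"
    and "i + k \<le> 2 ^ n"
  shows "\<bar>grid_value lam r a s b \<omega> n (i + k) - grid_value lam r a s b \<omega> n i\<bar>
       \<le> c * (real k * ((s - r) / 2 ^ n))"
  using assms(5)
proof (induction k)
  case (Suc k)
  then have "\<bar>grid_value lam r a s b \<omega> n (Suc (i + k)) - grid_value lam r a s b \<omega> n (i + k)\<bar>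
      \<le> c * ((s - r) / 2 ^ n)"
    using assms by (intro grid_value_step) auto
  moreover have "c * (real (Suc k) * ((s - r) / 2 ^ n))
      = c * (real k * ((s - r) / 2 ^ n)) + c * ((s - r) / 2 ^ n)"
    by (simp only: of_nat_Suc distrib_right distrib_left mult_1)
  ultimately show ?case using Suc by simp
qed simp

text \<open>Two grid points are compared on a common refinement of their levels.  For equal points the
  bound is zero, so the grid values define a function of the point alone.\<close>

lemma grid_value_lipschitz:
  assumes "0 \<le> r" "r < s" "\<bar>b - a\<bar> \<le> c * (s - r)" "\<omega> \<in> dyadics r s \<rightarrow> {0..1}"
    and "i \<le> 2 ^ m" "j \<le> 2 ^ n"
  shows "\<bar>grid_value lam r a s b \<omega> n j - grid_value lam r a s b \<omega> m i\<bar>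
       \<le> c * \<bar>dyadic_point r s n j - dyadic_point r s m i\<bar>"
proof -
  let ?g = "grid_value lam r a s b \<omega>" and ?t = "dyadic_point r s"
  have same: "\<bar>?g N k - ?g N l\<bar> \<le> c * \<bar>?t N k - ?t N l\<bar>" if "l \<le> k" "k \<le> 2 ^ N" for N k l
  proof -
    have "?t N k - ?t N l = real (k - l) * ((s - r) / 2 ^ N)"
      using that by (simp add: dyadic_point_diff of_nat_diff)
    moreover have "\<bar>?g N (l + (k - l)) - ?g N l\<bar> \<le> c * (real (k - l) * ((s - r) / 2 ^ N))"
      using assms that by (intro grid_value_lipschitz_same_level) auto
    ultimately show ?thesis using that assms(2) by simp
  qed
  have same': "\<bar>?g N k - ?g N l\<bar> \<le> c * \<bar>?t N k - ?t N l\<bar>" if "l \<le> 2 ^ N" "k \<le> 2 ^ N" for N k l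
    using same[of l k N] same[of k l N] that by (metis abs_minus_commute nat_le_linear)
  have "?g (m + n) (i * 2 ^ n) = ?g m i" "?t (m + n) (i * 2 ^ n) = ?t m i"
    "?g (m + n) (j * 2 ^ m) = ?g n j" "?t (m + n) (j * 2 ^ m) = ?t n j"
    by (simp_all only: grid_value_refine dyadic_point_refine add.commute[of m n])
      (simp_all only: grid_value_refine dyadic_point_refine add.commute[of n m])
  moreover have "i * 2 ^ n \<le> 2 ^ (m + n)" "j * 2 ^ m \<le> 2 ^ (m + n)"
    using assms(5,6) by (simp_all add: power_add mult.commute)
  ultimately show ?thesis
    using same'[of "i * 2 ^ n" "m + n" "j * 2 ^ m"] by simp
qed

text \<open>The Lipschitz grid values extend to the closure of the grid, and a continuous
  function is determined on that closure, so the definite description in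
  \<^const>\<open>bridge_path\<close> denotes the extension.\<close>

lemma bridge_path_works:
  assumes "0 \<le> r" "r < s" "\<bar>b - a\<bar> \<le> c * (s - r)" "\<omega> \<in> dyadics r s \<rightarrow> {0..1}"
  defines "x \<equiv> bridge_path lam r a s b \<omega>"
  shows "c-lipschitz_on {r..s} x"
    and "\<And>n j. j \<le> 2 ^ n \<Longrightarrow> x (dyadic_point r s n j) = grid_value lam r a s b \<omega> n j"
proof -
  let ?g = "grid_value lam r a s b \<omega>" and ?t = "dyadic_point r s"
  have "\<forall>q. \<exists>y. \<forall>n j. j \<le> 2 ^ n \<longrightarrow> ?t n j = q \<longrightarrow> ?g n j = y"
  proof
    fix q
    show "\<exists>y. \<forall>n j. j \<le> 2 ^ n \<longrightarrow> ?t n j = q \<longrightarrow> ?g n j = y"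
    proof (cases "\<exists>n j. j \<le> 2 ^ n \<and> ?t n j = q")
      case True
      then obtain m i where mi: "i \<le> 2 ^ m" "?t m i = q" by blast
      have "?g n j = ?g m i" if "j \<le> 2 ^ n" "?t n j = q" for n j
        using grid_value_lipschitz[OF assms(1-4) mi(1) that(1)] mi(2) that(2) by simp
      then show ?thesis by blast
    qed auto
  qed
  then obtain h where h: "\<And>n j. j \<le> 2 ^ n \<Longrightarrow> h (?t n j) = ?g n j"
    by metis
  have "c-lipschitz_on (dyadic_grid r s) h"
    using c_pos h grid_value_lipschitz[OF assms(1-4)]
    by (intro lipschitz_onI) (auto simp: dyadic_grid_def dist_real_def)
  then obtain y where y: "c-lipschitz_on {r..s} y" "\<And>q. q \<in> dyadic_grid r s \<Longrightarrow> y q = h q"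
    using lipschitz_extend_closure[of c "dyadic_grid r s" h] closure_dyadic_grid[OF assms(2)] by metis
  define P where "P x \<longleftrightarrow> x \<in> extensional {r..s} \<and> continuous_on {r..s} x \<and>
        (\<forall>n j. j \<le> 2 ^ n \<longrightarrow> x (?t n j) = ?g n j)" for x :: "real \<Rightarrow> real"
  have unfold: "x = (THE x. P x)"
    by (simp add: x_def bridge_path_def P_def)
  let ?y = "restrict y {r..s}"
  have lip: "c-lipschitz_on {r..s} ?y"
    using y(1) by (rule lipschitz_on_transform) simp
  have "?y (?t n j) = ?g n j" if "j \<le> 2 ^ n" for n j
  proof -
    have "?t n j \<in> dyadic_grid r s"
      using that by (auto simp: dyadic_grid_def)
    then show ?thesis
      using h[OF that] y(2) dyadic_point_bounds[OF assms(2) that] by simp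
  qed
  then have Py: "P ?y"
    using lipschitz_on_continuous_on[OF lip] by (simp add: P_def)
  have "w = ?y" if "P w" for w
  proof (rule extensionalityI[of _ "{r..s}"])
    fix t assume t: "t \<in> {r..s}"
    have "continuous_on (closure (dyadic_grid r s)) (\<lambda>t. w t - ?y t)"
      using that Py by (auto simp: P_def closure_dyadic_grid[OF assms(2)] intro!: continuous_on_diff)
    then have "w t - ?y t = 0"
    proof (rule continuous_constant_on_closure)
      show "t \<in> closure (dyadic_grid r s)"
        using t by (simp add: closure_dyadic_grid[OF assms(2)])
      show "w q - ?y q = 0" if "q \<in> dyadic_grid r s" for q
        using that \<open>P w\<close> Py unfolding P_def dyadic_grid_def by force
    qed
    then show "w t = ?y t" by simp
  qed (use that Py in \<open>auto simp: P_def\<close>)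
  then have "x = ?y"
    unfolding unfold using Py by (intro the_equality)
  then show "c-lipschitz_on {r..s} x"
    "\<And>n j. j \<le> 2 ^ n \<Longrightarrow> x (?t n j) = ?g n j"
    using lip Py by (simp_all add: P_def)
qed

text \<open>The interval on which \<open>lam\<close> acts has fixed ends in time; only the positions of its ends and
  the parameter coordinate vary with \<open>z\<close>, and by \<open>grid_value_step\<close> they stay in the
  region where \<open>lam\<close> is continuous.\<close>

lemma continuous_map_grid_value:
  assumes "0 \<le> r" "r < s"
    and "continuous_map Z euclideanreal a" "continuous_map Z euclideanreal b"
    and ab: "\<And>z. z \<in> topspace Z \<Longrightarrow> \<bar>b z - a z\<bar> \<le> c * (s - r)"
    and \<omega>: "\<And>v. v \<in> dyadics r s \<Longrightarrow> continuous_map Z (top_of_set {0..1}) (\<lambda>z. \<omega> z v)"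
    and "j \<le> 2 ^ n"
  shows "continuous_map Z euclideanreal (\<lambda>z. grid_value lam r (a z) s (b z) (\<omega> z) n j)"
  using assms(7)
proof (induction n arbitrary: j)
  case 0
  then show ?case using assms(3,4) by simp
next
  case (Suc n)
  show ?case
  proof (cases "even j")
    case True
    then show ?thesis using Suc by auto
  next
    case False
    then obtain i where i: "j = 2 * i + 1" by (auto elim: oddE)
    then have i': "i < 2 ^ n" using Suc.prems by simp
    let ?t = "dyadic_point r s"
    have len: "?t n (i + 1) - ?t n i = (s - r) / 2 ^ n"
      by (simp add: dyadic_point_diff)
    have \<omega>01: "\<omega> z \<in> dyadics r s \<rightarrow> {0..1}" if "z \<in> topspace Z" for z
      using \<omega> that by (auto simp: continuous_map_def)
    have "continuous_map Z euclideanreal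
      (\<lambda>z. lam (?t n i) (grid_value lam r (a z) s (b z) (\<omega> z) n i)
               (?t n (i + 1)) (grid_value lam r (a z) s (b z) (\<omega> z) n (i + 1))
               (\<omega> z (?t (Suc n) j)))"
    proof (rule continuous_map_lam)
      show "0 \<le> ?t n i"
        using dyadic_point_bounds(1)[of r s i n] assms(1,2) i' by simp
      show "?t n i < ?t n (i + 1)"
        using len assms(2) by (metis diff_gt_0_iff_gt divide_pos_pos zero_less_numeral zero_less_power)
      show "continuous_map Z (top_of_set {0..1}) (\<lambda>z. \<omega> z (?t (Suc n) j))"
        using i i' by (intro \<omega> dyadic_point_in_dyadics) auto
      show "\<bar>grid_value lam r (a z) s (b z) (\<omega> z) n (i + 1) - grid_value lam r (a z) s (b z) (\<omega> z) n i\<bar>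
          \<le> c * (?t n (i + 1) - ?t n i)" if "z \<in> topspace Z" for z
        unfolding len using grid_value_step[OF assms(1,2) ab[OF that] \<omega>01[OF that] i'] by simp
    qed (use Suc.IH i' in auto)
    then show ?thesis using i by simp
  qed
qed

lemma continuous_map_bridge_path:
  assumes "0 \<le> r" "r < s"
    and "continuous_map Z euclideanreal a" "continuous_map Z euclideanreal b"
    and ab: "\<And>z. z \<in> topspace Z \<Longrightarrow> \<bar>b z - a z\<bar> \<le> c * (s - r)"
    and \<omega>: "\<And>v. v \<in> dyadics r s \<Longrightarrow> continuous_map Z (top_of_set {0..1}) (\<lambda>z. \<omega> z v)"
    and t: "t \<in> {r..s}"
  shows "continuous_map Z euclideanreal (\<lambda>z. bridge_path lam r (a z) s (b z) (\<omega> z) t)"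
proof (rule equilipschitz_continuous_at_closure)
  have \<omega>01: "\<omega> z \<in> dyadics r s \<rightarrow> {0..1}" if "z \<in> topspace Z" for z
    using \<omega> that by (auto simp: continuous_map_def)
  note works = bridge_path_works[OF assms(1,2) ab \<omega>01]
  show "t \<in> closure (dyadic_grid r s)"
    using t by (simp add: closure_dyadic_grid[OF assms(2)])
  show "c-lipschitz_on (closure (dyadic_grid r s)) (bridge_path lam r (a z) s (b z) (\<omega> z))"
    if "z \<in> topspace Z" for z
    using works(1)[OF that that] by (simp add: closure_dyadic_grid[OF assms(2)])
  fix q assume "q \<in> dyadic_grid r s"
  then obtain n j where q: "q = dyadic_point r s n j" "j \<le> 2 ^ n"
    by (auto simp: dyadic_grid_def)
  have "continuous_map Z euclideanreal (\<lambda>z. grid_value lam r (a z) s (b z) (\<omega> z) n j)"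
    using assms q(2) by (intro continuous_map_grid_value) auto
  then show "continuous_map Z euclideanreal (\<lambda>z. bridge_path lam r (a z) s (b z) (\<omega> z) q)"
    using works(2) q by (elim continuous_map_eq) simp
qed

section \<open>Paths with a free right end\<close>

lemma free_path_works:
  assumes "0 \<le> r" "r < s" "\<omega> \<in> dyadics_end r s \<rightarrow> {0..1}"
  shows "c-lipschitz_on {r..s} (free_path lam mu r a s \<omega>)"
    and "free_path lam mu r a s \<omega> r = a"
proof -
  have b: "\<bar>mu r a s (\<omega> s) - a\<bar> \<le> c * (s - r)"
    using assms by (intro mu_bound) (auto simp: dyadics_end_def)
  have \<omega>: "restrict \<omega> (dyadics r s) \<in> dyadics r s \<rightarrow> {0..1}"
    using assms(3) by (auto simp: dyadics_end_def)
  note works = bridge_path_works[OF assms(1,2) b \<omega>]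
  show "c-lipschitz_on {r..s} (free_path lam mu r a s \<omega>)"
    using works(1) by (simp add: free_path_def)
  show "free_path lam mu r a s \<omega> r = a"
    using works(2)[of 0 0] by (simp add: free_path_def dyadic_point_def)
qed

lemma continuous_map_free_path:
  assumes "0 \<le> r" "r < s" "continuous_map Z euclideanreal a"
    and \<omega>: "\<And>v. v \<in> dyadics_end r s \<Longrightarrow> continuous_map Z (top_of_set {0..1}) (\<lambda>z. \<omega> z v)"
    and "t \<in> {r..s}"
  shows "continuous_map Z euclideanreal (\<lambda>z. free_path lam mu r (a z) s (\<omega> z) t)"
  unfolding free_path_def
proof (rule continuous_map_bridge_path)
  have s: "s \<in> dyadics_end r s" by (simp add: dyadics_end_def)
  show "continuous_map Z euclideanreal (\<lambda>z. mu r (a z) s (\<omega> z s))"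
    using assms s by (intro continuous_map_mu) auto
  show "\<bar>mu r (a z) s (\<omega> z s) - a z\<bar> \<le> c * (s - r)" if "z \<in> topspace Z" for z
  proof (rule mu_bound)
    show "\<omega> z s \<in> {0..1}" using \<omega>[OF s] that by (auto simp: continuous_map_def)
  qed fact+
  show "continuous_map Z (top_of_set {0..1}) (\<lambda>z. restrict (\<omega> z) (dyadics r s) v)"
    if "v \<in> dyadics r s" for v
    using that \<omega>[of v] by (simp add: dyadics_end_def)
qed fact+

section \<open>Rays\<close>

lemma next_nat_greater: "r < real (next_nat r)"
  unfolding next_nat_def using reals_Archimedean2[of r] by (metis LeastI)

lemma dyadics_end_subset_ray_index:
  "dyadics_end r (real (next_nat r)) \<subseteq> ray_index r"
  "dyadics_end (real (next_nat r + k)) (real (next_nat r + k + 1)) \<subseteq> ray_index r"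
  by (auto simp: ray_index_def simp del: of_nat_add intro!: UN_I[of "next_nat r + k"])

text \<open>A concatenation of two \<open>c\<close>-Lipschitz paths is \<open>c\<close>-Lipschitz provided they agree where
  they meet, which they do because each free path starts where the segment before it ends.\<close>

lemma ray_segment_works:
  assumes "0 \<le> r" "\<omega> \<in> ray_index r \<rightarrow> {0..1}"
  shows "c-lipschitz_on {r..real (next_nat r + k)} (ray_segment lam mu r a \<omega> k)
       \<and> ray_segment lam mu r a \<omega> k r = a"
proof (induction k)
  case 0
  have "restrict \<omega> (dyadics_end r (real (next_nat r))) \<in> dyadics_end r (real (next_nat r)) \<rightarrow> {0..1}"
    using assms(2) dyadics_end_subset_ray_index(1)[of r] by auto
  from free_path_works[OF assms(1) next_nat_greater this]
  show ?case by simp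
next
  case (Suc k)
  define j where "j = next_nat r + k"
  define I where "I = dyadics_end (real j) (real (j + 1))"
  define x where "x = ray_segment lam mu r a \<omega> k"
  define y where "y = free_path lam mu (real j) (x (real j)) (real (j + 1)) (restrict \<omega> I)"
  have rj: "r < real j"
    using next_nat_greater[of r] by (simp add: j_def)
  have "restrict \<omega> I \<in> I \<rightarrow> {0..1}"
    using assms(2) dyadics_end_subset_ray_index(2)[of r k] by (auto simp: j_def I_def)
  then have y: "c-lipschitz_on {real j..real (j + 1)} y" "y (real j) = x (real j)"
    using free_path_works[of "real j" "real (j + 1)" "restrict \<omega> I" "x (real j)"]
    by (simp_all add: y_def I_def)
  have x: "c-lipschitz_on {r..real j} x" "x r = a"
    using Suc.IH by (simp_all only: j_def x_def)
  have eq: "ray_segment lam mu r a \<omega> (Suc k)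
      = (\<lambda>t\<in>{r..real (j + 1)}. if t \<le> real j then x t else y t)"
    by (simp only: ray_segment.simps Let_def j_def x_def y_def I_def)
  have "c-lipschitz_on {r..real (j + 1)} (\<lambda>t\<in>{r..real (j + 1)}. if t \<le> real j then x t else y t)"
    using lipschitz_on_concat[OF x(1) y(1) y(2)[symmetric]]
    by (rule lipschitz_on_transform) simp
  moreover have "(\<lambda>t\<in>{r..real (j + 1)}. if t \<le> real j then x t else y t) r = a"
    using x(2) rj by simp
  moreover have "real (next_nat r + Suc k) = real (j + 1)"
    by (simp add: j_def)
  ultimately show ?case
    unfolding eq by simp
qed

text \<open>On the last unit interval the start \<open>ray_segment lam mu r (a z) (\<omega> z) k (real j)\<close> depends
  on \<open>z\<close> through all earlier choices; the induction hypothesis says that it does so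
  continuously.\<close>

lemma continuous_map_ray_segment:
  assumes "0 \<le> r" "continuous_map Z euclideanreal a"
    and \<omega>: "\<And>v. v \<in> ray_index r \<Longrightarrow> continuous_map Z (top_of_set {0..1}) (\<lambda>z. \<omega> z v)"
    and "t \<in> {r..real (next_nat r + k)}"
  shows "continuous_map Z euclideanreal (\<lambda>z. ray_segment lam mu r (a z) (\<omega> z) k t)"
  using assms(4)
proof (induction k arbitrary: t)
  case 0
  have "continuous_map Z (top_of_set {0..1})
      (\<lambda>z. restrict (\<omega> z) (dyadics_end r (real (next_nat r))) v)"
    if "v \<in> dyadics_end r (real (next_nat r))" for v
    using that \<omega>[of v] dyadics_end_subset_ray_index(1)[of r] by auto
  then show ?case
    using 0 assms(1,2) next_nat_greater[of r] by (simp add: continuous_map_free_path)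
next
  case (Suc k)
  define j where "j = next_nat r + k"
  let ?I = "dyadics_end (real j) (real (j + 1))"
  have rj: "r < real j"
    using next_nat_greater[of r] by (simp add: j_def)
  have t: "t \<in> {r..real (j + 1)}"
    using Suc.prems by (simp add: j_def)
  have eq: "ray_segment lam mu r (a z) (\<omega> z) (Suc k) t
      = (if t \<le> real j then ray_segment lam mu r (a z) (\<omega> z) k t
         else free_path lam mu (real j) (ray_segment lam mu r (a z) (\<omega> z) k (real j)) (real (j + 1))
           (restrict (\<omega> z) ?I) t)" for z
    using t by (simp only: ray_segment.simps Let_def restrict_apply if_True flip: j_def)
  show ?case
  proof (cases "t \<le> real j")
    case True
    then show ?thesis
      unfolding eq using Suc.IH[of t] t by (simp add: j_def)
  next
    case False
    have "continuous_map Z (top_of_set {0..1}) (\<lambda>z. restrict (\<omega> z) ?I v)" if "v \<in> ?I" for v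
      using that \<omega>[of v] dyadics_end_subset_ray_index(2)[of r k] by (auto simp: j_def)
    moreover have "continuous_map Z euclideanreal (\<lambda>z. ray_segment lam mu r (a z) (\<omega> z) k (real j))"
      using Suc.IH[of "real j"] rj by (simp add: j_def)
    ultimately have "continuous_map Z euclideanreal
      (\<lambda>z. free_path lam mu (real j) (ray_segment lam mu r (a z) (\<omega> z) k (real j)) (real (j + 1))
           (restrict (\<omega> z) ?I) t)"
      using t False by (intro continuous_map_free_path) auto
    then show ?thesis unfolding eq using False by simp
  qed
qed

end

lemma ray_segment_extends:
  assumes "r \<le> t" "t \<le> real (next_nat r + k)"
  shows "ray_segment lam mu r a \<omega> (k + d) t = ray_segment lam mu r a \<omega> k t"
proof (induction d)
  case (Suc d)
  then show ?case using assms by (simp add: Let_def)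
qed simp

text \<open>The index of the segment need not be the least one, so a single segment can be used for
  several times at once.\<close>

lemma ray_path_eq_ray_segment:
  assumes "r \<le> t" "t \<le> real (next_nat r + k)"
  shows "ray_path lam mu r a \<omega> t = ray_segment lam mu r a \<omega> k t"
proof -
  define l where "l = (LEAST k. t \<le> real (next_nat r + k))"
  have "t \<le> real (next_nat r + l)" "l \<le> k"
    unfolding l_def using assms(2) by (rule LeastI, intro Least_le)
  then have "ray_segment lam mu r a \<omega> k t = ray_segment lam mu r a \<omega> l t"
    using ray_segment_extends[OF assms(1), of l lam mu a \<omega> "k - l"] by simp
  then show ?thesis
    using assms(1) by (simp add: ray_path_def l_def)
qed

context speed_bounded_choices
begin

lemma ray_path_in_lipschitz_rays_from:
  assumes "0 \<le> r" "\<omega> \<in> ray_index r \<rightarrow> {0..1}"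
  shows "ray_path lam mu r a \<omega> \<in> lipschitz_rays_from c r a"
proof -
  let ?x = "ray_path lam mu r a \<omega>"
  have "dist (?x u) (?x v) \<le> c * dist u v" if uv: "u \<in> {r..}" "v \<in> {r..}" for u v
  proof -
    obtain k where "max u v \<le> real k"
      using real_arch_simple by blast
    then have k: "u \<le> real (next_nat r + k)" "v \<le> real (next_nat r + k)"
      by auto
    show ?thesis
      using ray_segment_works[OF assms, of k a] uv k
      by (auto simp: ray_path_eq_ray_segment[OF _ k(1)] ray_path_eq_ray_segment[OF _ k(2)]
          intro: lipschitz_onD)
  qed
  then have "c-lipschitz_on {r..} ?x"
    using c_pos by (intro lipschitz_onI) auto
  moreover have "?x r = a"
    using ray_segment_works[OF assms, of 0 a] ray_path_eq_ray_segment[of r r 0] next_nat_greater[of r]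
    by simp
  moreover have "?x \<in> extensional {r..}"
    by (simp add: ray_path_def)
  ultimately show ?thesis
    using c_pos by (simp add: lipschitz_rays_from_def lipschitz_rays_iff)
qed

lemma continuous_map_ray_path:
  assumes "0 \<le> r" "continuous_map Z euclideanreal a"
    and \<omega>: "\<And>v. v \<in> ray_index r \<Longrightarrow> continuous_map Z (top_of_set {0..1}) (\<lambda>z. \<omega> z v)"
  shows "continuous_map Z (ray_topology r) (\<lambda>z. ray_path lam mu r (a z) (\<omega> z))"
proof (rule continuous_map_into_ray_topology)
  show "0 \<le> c" using c_pos by simp
  show "ray_path lam mu r (a z) (\<omega> z) \<in> lipschitz_rays c r" if "z \<in> topspace Z" for z
  proof -
    have "\<omega> z \<in> ray_index r \<rightarrow> {0..1}"
      using \<omega> that by (auto simp: continuous_map_def)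
    then show ?thesis
      using ray_path_in_lipschitz_rays_from[OF assms(1)] by (simp add: lipschitz_rays_from_def)
  qed
  fix t assume "r \<le> t"
  obtain k where "t \<le> real k"
    using real_arch_simple by blast
  then have k: "t \<le> real (next_nat r + k)" by simp
  show "continuous_map Z euclideanreal (\<lambda>z. ray_path lam mu r (a z) (\<omega> z) t)"
    unfolding ray_path_eq_ray_segment[OF \<open>r \<le> t\<close> k]
    using assms(1,2) \<omega>
  proof (rule continuous_map_ray_segment)
    show "t \<in> {r..real (next_nat r + k)}"
      using \<open>r \<le> t\<close> k by simp
  qed
qed

end

theorem theorem2p8:
  fixes c r :: real
    and lam :: "real \<Rightarrow> real \<Rightarrow> real \<Rightarrow> real \<Rightarrow> real \<Rightarrow> real"
    and mu :: "real \<Rightarrow> real \<Rightarrow> real \<Rightarrow> real \<Rightarrow> real"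
  assumes "c > 0"
    and "\<And>r a s b. 0 \<le> r \<Longrightarrow> r < s \<Longrightarrow> parallelogram c r a s b \<noteq> {} \<Longrightarrow>
           continuous_on {0..1} (lam r a s b) \<and> lam r a s b ` {0..1} = mid_interval c r a s b"
    and "continuous_on
           {(a, b, r, s, \<xi>). 0 \<le> r \<and> r < s \<and> \<bar>b - a\<bar> \<le> c * (s - r) \<and> \<xi> \<in> {0..1}}
           (\<lambda>(a, b, r, s, \<xi>). lam r a s b \<xi>)"
    and "\<And>r a s. 0 \<le> r \<Longrightarrow> r < s \<Longrightarrow>
           continuous_on {0..1} (mu r a s) \<and> mu r a s ` {0..1} = end_interval c r a s"
    and "continuous_on {(a, r, s, \<xi>). 0 \<le> r \<and> r < s \<and> \<xi> \<in> {0..1}}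
           (\<lambda>(a, r, s, \<xi>). mu r a s \<xi>)"
    and "r \<ge> 0"
  shows "continuous_map (prod_topology euclideanreal (ray_parameters r))
           (subtopology (ray_topology r) (lipschitz_rays c r))
           (\<lambda>(a, \<omega>). ray_path lam mu r a \<omega>)
       \<and> (\<forall>a. continuous_map (ray_parameters r)
           (subtopology (ray_topology r) (lipschitz_rays_from c r a))
           (ray_path lam mu r a))"
proof -
  interpret speed_bounded_choices c lam mu
    using assms(1-5) by unfold_locales auto
  let ?Z = "prod_topology euclideanreal (ray_parameters r)"
  have coord: "continuous_map (ray_parameters r) (top_of_set {0..1}) (\<lambda>\<omega>. \<omega> v)"
    if "v \<in> ray_index r" for v
    unfolding ray_parameters_def using that by (rule continuous_map_product_projection)
  have starts: "ray_path lam mu r a \<omega> \<in> lipschitz_rays_from c r a"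
    if "\<omega> \<in> topspace (ray_parameters r)" for a \<omega>
    using that \<open>r \<ge> 0\<close>
    by (intro ray_path_in_lipschitz_rays_from) (auto simp: ray_parameters_def)
  have "continuous_map ?Z (ray_topology r) (\<lambda>z. ray_path lam mu r (fst z) (snd z))"
    using \<open>r \<ge> 0\<close> continuous_map_fst
      continuous_map_compose[OF continuous_map_snd coord, of _ euclideanreal]
    by (intro continuous_map_ray_path) (auto simp: o_def)
  then have "continuous_map ?Z (subtopology (ray_topology r) (lipschitz_rays c r))
      (\<lambda>(a, \<omega>). ray_path lam mu r a \<omega>)"
    using starts
    by (intro continuous_map_into_subtopology)
      (auto simp: case_prod_unfold lipschitz_rays_from_def)
  moreover have "continuous_map (ray_parameters r)
      (subtopology (ray_topology r) (lipschitz_rays_from c r a)) (ray_path lam mu r a)" for a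
    using continuous_map_ray_path[OF \<open>r \<ge> 0\<close>, of "ray_parameters r" "\<lambda>_. a" "\<lambda>\<omega>. \<omega>"] coord starts
    by (intro continuous_map_into_subtopology) auto
  ultimately show ?thesis by blast
qed

end
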